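(* Let $s\geq 3$ be an integer, $m=2s$, $q=2^m$, and let $\overline{\mathcal{C}_1^{\bot}}^{\bot}$ be the binary linear code $$\overline{\mathcal{C}_1^{\bot}}^{\bot}=\{(\mathrm{Tr}_1^m(ax^5+bx^3+cx)+h)_{x\in\mathbb{F}_q}: a,b,c\in\mathbb{F}_q,\ h\in\mathbb{F}_2\}.$$ Then this code has length $2^m$ and dimension $3m+1$ over $\mathbb{F}_2$, and its weight distribution is as follows (the number of codewords of any weight not listed is $0$): - weight $0$: $1$ codeword; - weight $2^{2s-1}$: $29\cdot 2^{6s-5}-33\cdot 2^{4s-5}+17\cdot 2^{2s-3}-2$ codewords; - weight $2^{2s-1}-2^{s-1}$: $\frac{2}{15}\cdot 2^{2s}(3\cdot 2^{4s}+5\cdot 2^{2s}-8)$ codewords; - weight $2^{2s-1}+2^{s-1}$: $\frac{2}{15}\cdot 2^{2s}(3\cdot 2^{4s}+5\cdot 2^{2s}-8)$ codewords; - weight $2^{2s-1}-2^{s}$: $\frac{7}{3}\cdot 2^{4s-4}(2^{2s}-1)$ codewords; - weight $2^{2s-1}+2^{s}$: $\frac{7}{3}\cdot 2^{4s-4}(2^{2s}-1)$ codewords; - weight $2^{2s-1}-2^{s+1}$: $\frac{1}{15}\cdot 2^{2s-4}(2^{4s-2}-5\cdot 2^{2s-2}+1)$ codewords; - weight $2^{2s-1}+2^{s+1}$: $\frac{1}{15}\cdot 2^{2s-4}(2^{4s-2}-5\cdot 2^{2s-2}+1)$ codewords; - weight $2^{2s}$: $1$ codeword.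
   Context: $\mathbb{F}_q$ is the finite field with $q=2^m$ elements, and $\mathrm{Tr}_1^m$ is the trace function from $\mathbb{F}_{2^m}$ onto $\mathbb{F}_2$. The weight distribution of a code records, for each $i$, the number of codewords of Hamming weight $i$. The notation $\overline{\mathcal{C}_1^{\bot}}^{\bot}$ is just the name of the displayed code (it is the dual of the extended code of the dual of the cyclic code $\mathcal{C}_1$ formed by the vectors $(\mathrm{Tr}_1^m(ax^5+bx^3+cx))_{x\in\mathbb{F}_q^*}$). *)

theory Defs
  imports "HOL-Analysis.Analysis" "HOL-Library.Z2"
    "HOL-Number_Theory.Residues"
begin

text \<open>
  Binary words of length \<open>n\<close> are elements of \<open>bit ^ 'n\<close> with \<open>CARD('n) = n\<close>; the coordinates
  may be indexed by any finite type, in particular by a finite field. Linearity and dimension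
  over the two-element field \<open>bit\<close> are \<open>vec.subspace\<close> and \<open>vec.dim\<close>.
\<close>

definition code_length :: "(bit ^ 'n::finite) set \<Rightarrow> nat" where
  "code_length C = CARD('n)"

definition hamming_weight :: "bit ^ 'n::finite \<Rightarrow> nat" where
  "hamming_weight v = card {i. v $ i \<noteq> 0}"

definition weight_distribution :: "(bit ^ 'n::finite) set \<Rightarrow> nat \<Rightarrow> nat" where
  "weight_distribution C w = card {v \<in> C. hamming_weight v = w}"

text \<open>
  The absolute trace of a field with \<open>2 ^ m\<close> elements. The sum of conjugates is an element of
  the big field lying in its prime subfield; it is pulled back to \<open>bit\<close> along the embedding
  \<open>of_bit\<close> (see \<open>of_bit_trace2\<close> below for well-definedness).
\<close>

definition trace2 :: "nat \<Rightarrow> 'a::finite_field \<Rightarrow> bit" where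
  "trace2 m x = (THE t. of_bit t = (\<Sum>i<m. x ^ (2 ^ i)))"

lemma of_bit_trace2:
  fixes x :: "'a::finite_field"
  assumes card: "CARD('a) = 2 ^ m"
  shows "of_bit (trace2 m x) = (\<Sum>i<m. x ^ (2 ^ i))"
proof -
  let ?S = "\<Sum>i<m. x ^ (2 ^ i)"
  have "CHAR('a) dvd 2 ^ m"
    using CHAR_dvd_CARD[where ?'a = 'a] card by simp
  moreover have "prime CHAR('a)"
    by (rule prime_CHAR_semidom) (rule finite_imp_CHAR_pos, simp)
  ultimately have char2: "CHAR('a) = 2"
    by (metis prime_dvd_power primes_dvd_imp_eq two_is_prime_nat)
  have "?S ^ 2 = (\<Sum>i<m. (x ^ (2 ^ i)) ^ 2)"
    by (rule freshmans_dream_sum) (simp_all add: char2)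
  also have "\<dots> = (\<Sum>i<m. x ^ (2 ^ Suc i))"
    by (simp only: power_mult[symmetric] power_Suc mult.commute)
  finally have "?S ^ 2 + x = (\<Sum>i<Suc m. x ^ (2 ^ i))"
    by (simp only: sum.lessThan_Suc_shift power_0 power_one_right add.commute)
  also have "\<dots> = ?S + x"
    using finite_field_power_card_eq_same[of x] card by (simp only: sum.lessThan_Suc)
  finally have "?S ^ 2 = ?S"
    by (rule add_right_imp_eq)
  then have "?S = 0 \<or> ?S = 1"
    by (simp add: power2_eq_square)
  then have "\<exists>!t::bit. of_bit t = ?S"
  proof (elim disjE)
    show "?S = 0 \<Longrightarrow> \<exists>!t::bit. of_bit t = ?S" by (intro ex1I[of _ 0]) auto
    show "?S = 1 \<Longrightarrow> \<exists>!t::bit. of_bit t = ?S" by (intro ex1I[of _ 1]) auto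
  qed
  then show ?thesis
    unfolding trace2_def by (rule theI')
qed

definition trace_code :: "nat \<Rightarrow> (bit ^ 'a::finite_field) set" where
  "trace_code m = {(\<chi> x. trace2 m (a * x ^ 5 + b * x ^ 3 + c * x) + h) | a b c h. True}"

end

theory Submission
  imports Defs
begin

text \<open>
  For a word \<open>v\<close> let \<open>S v = (\<Sum>i. (- 1) ^ v $ i)\<close>, so that \<open>S v = q - 2 * hamming_weight v\<close>.

  Squaring shows that for \<open>(a, b) \<noteq> (0, 0)\<close> the value \<open>(S v)\<^sup>2\<close> is \<open>0\<close> or \<open>q\<close> times the size
  of the radical of the quadratic form \<open>trace2 m (a x\<^sup>5 + b x\<^sup>3 + c x)\<close>. The radical is the zero
  set of a linearized polynomial of degree at most 16, and \<open>q\<close> is a square, hence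
  \<open>S v \<in> {0, \<plusminus>2 ^ s, \<plusminus>2 ^ (s + 1), \<plusminus>2 ^ (s + 2)}\<close>. Adding the all-one word changes the sign of
  \<open>S\<close>, so four multiplicities remain unknown.

  A word of the dual code with support \<open>D\<close> has \<open>(\<Sum>x\<in>D. x ^ k) = 0\<close> for \<open>k \<le> 5\<close>, so \<open>D\<close> has more
  than 6 elements if it is nonempty. Therefore the moments \<open>(\<Sum>v\<in>C. S v ^ n)\<close> with \<open>n \<le> 6\<close>
  depend only on \<open>q\<close> and \<open>card C\<close>, and those with \<open>n = 0, 2, 4, 6\<close> determine the four
  multiplicities.
\<close>

subsection \<open>Binary words and their power moments\<close>

text \<open>By default the simplifier turns arithmetic on \<^typ>\<open>bit\<close> into bit operations.\<close>

declare add_bit_eq_xor [simp del] mult_bit_eq_and [simp del]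

instance bit :: finite
proof
  have "(UNIV :: bit set) \<subseteq> {0, 1}"
    using bit_not_zero_iff by blast
  then show "finite (UNIV :: bit set)"
    by (rule finite_subset) simp
qed

definition bit_sign :: "bit \<Rightarrow> real" where
  "bit_sign t = (if t = 0 then 1 else - 1)"

lemma bit_add_self [simp]: "t + t = (0 :: bit)"
  by (cases t) simp_all

lemma bit_sign_0 [simp]: "bit_sign 0 = 1"
  and bit_sign_1 [simp]: "bit_sign 1 = - 1"
  by (simp_all add: bit_sign_def)

lemma bit_sign_mult_self [simp]: "bit_sign t * bit_sign t = 1"
  by (cases t) simp_all

lemma bit_sign_add: "bit_sign (t + u) = bit_sign t * bit_sign u"
  by (cases t; cases u) simp_all

lemma bit_sign_sum: "bit_sign (\<Sum>x\<in>D. g x) = (\<Prod>x\<in>D. bit_sign (g x))"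
  by (induction D rule: infinite_finite_induct) (simp_all add: bit_sign_add)

text \<open>Either all signs are \<open>1\<close>, or some \<open>r\<close> in \<open>R\<close> has
  \<open>g r = 1\<close>. Translation by \<open>r\<close> then permutes the finite set
  \<open>R\<close> and flips every sign, so the sum equals its own negative. This serves for the
  code, for the field and for the radical.\<close>

lemma sum_bit_sign_additive:
  fixes R :: "'b::cancel_semigroup_add set" and g :: "'b \<Rightarrow> bit"
  assumes fin: "finite R"
    and closed: "\<And>x y. x \<in> R \<Longrightarrow> y \<in> R \<Longrightarrow> x + y \<in> R"
    and additive: "\<And>x y. x \<in> R \<Longrightarrow> y \<in> R \<Longrightarrow> g (x + y) = g x + g y"
  shows "(\<Sum>x\<in>R. bit_sign (g x)) = (if \<forall>x\<in>R. g x = 0 then real (card R) else 0)"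
proof (cases "\<forall>x\<in>R. g x = 0")
  case False
  then obtain r where r: "r \<in> R" "g r = 1" by auto
  have "inj_on (\<lambda>x. x + r) R" by (simp add: inj_on_def)
  then have "bij_betw (\<lambda>x. x + r) R R"
    using endo_inj_surj[OF fin, of "\<lambda>x. x + r"] closed r by (auto simp: bij_betw_def)
  then have "(\<Sum>x\<in>R. bit_sign (g x)) = (\<Sum>x\<in>R. bit_sign (g (x + r)))"
    by (rule sum.reindex_bij_betw[symmetric])
  also have "\<dots> = (\<Sum>x\<in>R. - bit_sign (g x))"
    using r additive by (intro sum.cong) (simp_all add: bit_sign_add)
  finally show ?thesis using False by (auto simp: sum_negf)
qed simp

definition char_sum :: "bit ^ 'n::finite \<Rightarrow> real" where
  "char_sum v = (\<Sum>i\<in>UNIV. bit_sign (v $ i))"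

lemma char_sum_conv_weight: "char_sum v = real CARD('n) - 2 * real (hamming_weight v)"
  for v :: "bit ^ 'n::finite"
proof -
  have "bit_sign t = 1 - 2 * of_bool (t \<noteq> 0)" for t
    by (cases t) simp_all
  then have "char_sum v = (\<Sum>i\<in>UNIV. 1 - 2 * of_bool (v $ i \<noteq> 0))"
    unfolding char_sum_def by presburger
  then show ?thesis
    by (simp add: sum_subtractf hamming_weight_def flip: sum_distrib_left)
qed

text \<open>
  \<open>parity_walk q n d\<close> counts the words of length \<open>n\<close> over \<open>q\<close> letters for which the letters
  of odd multiplicity form a prescribed set of size \<open>d\<close>.
\<close>

fun parity_walk :: "nat \<Rightarrow> nat \<Rightarrow> nat \<Rightarrow> real" where
  "parity_walk q 0 d = of_bool (d = 0)"
| "parity_walk q (Suc n) d =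
    real d * parity_walk q n (d - 1) + (real q - real d) * parity_walk q n (d + 1)"

text \<open>Signs square to \<open>1\<close>, so a factor \<open>char_sum v\<close> toggles one
  coordinate of the product: an index in \<open>D\<close> leaves, an index outside joins. This is
  the recursion of \<open>parity_walk\<close>. \<open>D\<close> grows by at most one per factor, so
  \<open>n + card D \<le> t\<close> keeps every set that arises within reach of
  \<open>dual\<close>.\<close>

lemma char_sum_moments_aux:
  fixes C :: "(bit ^ 'n::finite) set"
  assumes sub: "vec.subspace C"
    and dual: "\<And>D :: 'n set. D \<noteq> {} \<Longrightarrow> card D \<le> t \<Longrightarrow> \<exists>v\<in>C. (\<Sum>i\<in>D. v $ i) \<noteq> 0"
    and "n + card D \<le> t"
  shows "(\<Sum>v\<in>C. char_sum v ^ n * (\<Prod>i\<in>D. bit_sign (v $ i)))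
    = real (card C) * parity_walk CARD('n) n (card D)"
  using assms(3)
proof (induction n arbitrary: D)
  case 0
  \<comment> \<open>The parity of \<open>v\<close> on \<open>D\<close> is additive in
    \<open>v\<close>; by \<open>dual\<close> it vanishes on all of \<open>C\<close> only for empty
    \<open>D\<close>.\<close>
  have "(\<Sum>v\<in>C. bit_sign (\<Sum>i\<in>D. v $ i)) = (if \<forall>v\<in>C. (\<Sum>i\<in>D. v $ i) = 0 then real (card C) else 0)"
    using vec.subspace_add[OF sub]
    by (intro sum_bit_sign_additive) (simp_all add: sum.distrib)
  moreover have "(\<forall>v\<in>C. (\<Sum>i\<in>D. v $ i) = 0) \<longleftrightarrow> D = {}"
    using dual[of D] 0 by (cases "D = {}") force+
  ultimately show ?case
    by (auto simp: bit_sign_sum)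
next
  case (Suc n)
  let ?P = "\<lambda>D v. \<Prod>i\<in>D. bit_sign (v $ i)"
  have D: "finite D" by simp
  have step: "char_sum v * ?P D v = (\<Sum>x\<in>D. ?P (D - {x}) v) + (\<Sum>x\<in>-D. ?P (insert x D) v)"
    for v :: "bit ^ 'n"
  proof -
    have "char_sum v * ?P D v = (\<Sum>x\<in>UNIV. bit_sign (v $ x) * ?P D v)"
      by (simp add: char_sum_def sum_distrib_right)
    also have "\<dots> = (\<Sum>x\<in>D. bit_sign (v $ x) * ?P D v) + (\<Sum>x\<in>-D. bit_sign (v $ x) * ?P D v)"
      by (subst sum.union_disjoint[symmetric]) (simp_all add: Compl_partition)
    also have "(\<Sum>x\<in>D. bit_sign (v $ x) * ?P D v) = (\<Sum>x\<in>D. ?P (D - {x}) v)"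
    proof (intro sum.cong refl)
      fix x assume "x \<in> D"
      then have "bit_sign (v $ x) * ?P D v = (bit_sign (v $ x) * bit_sign (v $ x)) * ?P (D - {x}) v"
        by (simp only: prod.remove[OF D] mult.assoc)
      then show "bit_sign (v $ x) * ?P D v = ?P (D - {x}) v" by simp
    qed
    finally show ?thesis by simp
  qed
  have "(\<Sum>v\<in>C. char_sum v ^ Suc n * ?P D v) = (\<Sum>v\<in>C. char_sum v ^ n * (char_sum v * ?P D v))"
    by (simp add: mult_ac)
  also have "\<dots> = (\<Sum>v\<in>C. (\<Sum>x\<in>D. char_sum v ^ n * ?P (D - {x}) v)
      + (\<Sum>x\<in>-D. char_sum v ^ n * ?P (insert x D) v))"
    unfolding step by (simp add: distrib_left sum_distrib_left)
  also have "\<dots> = (\<Sum>x\<in>D. \<Sum>v\<in>C. char_sum v ^ n * ?P (D - {x}) v)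
      + (\<Sum>x\<in>-D. \<Sum>v\<in>C. char_sum v ^ n * ?P (insert x D) v)"
    by (simp only: sum.distrib sum.swap[of _ C])
  also have "\<dots> = (\<Sum>x\<in>D. real (card C) * parity_walk CARD('n) n (card D - 1))
      + (\<Sum>x\<in>-D. real (card C) * parity_walk CARD('n) n (card D + 1))"
    using Suc.prems
    by (intro arg_cong2[where f = "(+)"] sum.cong refl; subst Suc.IH)
      (simp_all add: card_insert_if card_Diff_singleton)
  also have "\<dots> = real (card C) * parity_walk CARD('n) (Suc n) (card D)"
    using card_mono[of UNIV D]
    by (simp add: algebra_simps card_Diff_subset Compl_eq_Diff_UNIV of_nat_diff)
  finally show ?case .
qed

lemma char_sum_moments:
  fixes C :: "(bit ^ 'n::finite) set"
  assumes "vec.subspace C"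
    and "\<And>D :: 'n set. D \<noteq> {} \<Longrightarrow> card D \<le> t \<Longrightarrow> \<exists>v\<in>C. (\<Sum>i\<in>D. v $ i) \<noteq> 0"
    and "n \<le> t"
  shows "(\<Sum>v\<in>C. char_sum v ^ n) = real (card C) * parity_walk CARD('n) n 0"
  using char_sum_moments_aux[OF assms(1,2), where n = n and D = "{}"] assms(3) by simp

text \<open>Coefficients in \<open>bit\<close> are \<open>0\<close> or \<open>1\<close>, so linear
  combinations of a basis are its subset sums, and independence makes distinct subsets give distinct
  sums.\<close>

lemma card_subspace_bit:
  fixes C :: "(bit ^ 'n::finite) set"
  assumes sub: "vec.subspace C"
  shows "card C = 2 ^ vec.dim C"
proof -
  obtain B where B: "B \<subseteq> C" "vec.independent B" "C \<subseteq> vec.span B" "card B = vec.dim C"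
    using vec.basis_exists[of C] by metis
  have finB: "finite B" using vec.finiteI_independent[OF B(2)] .
  have span: "vec.span B = C"
    using B sub vec.span_minimal by blast
  let ?f = "\<lambda>X. \<Sum>v\<in>X. v"
  have rep: "?f X = (\<Sum>v\<in>B. of_bool (v \<in> X) *s v)" if "X \<subseteq> B" for X
  proof -
    have "(\<Sum>v\<in>B. of_bool (v \<in> X) *s v) = (\<Sum>v\<in>B. if v \<in> X then v else 0)"
      by (intro sum.cong) auto
    then show ?thesis using finB that by (simp add: sum.If_cases Int_absorb1)
  qed
  have "inj_on ?f (Pow B)"
  proof (rule inj_onI)
    fix X Y assume XY: "X \<in> Pow B" "Y \<in> Pow B" "?f X = ?f Y"
    have "(\<Sum>v\<in>B. (of_bool (v \<in> X) - of_bool (v \<in> Y) :: bit) *s v) = ?f X - ?f Y"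
      using XY by (simp only: rep Pow_iff sum_subtractf vector_sub_rdistrib)
    then have "(\<Sum>v\<in>B. (of_bool (v \<in> X) - of_bool (v \<in> Y) :: bit) *s v) = 0"
      using XY(3) by (simp only: right_minus_eq)
    then have "of_bool (v \<in> X) - of_bool (v \<in> Y) = (0 :: bit)" if "v \<in> B" for v
      by (rule vec.independentD[OF B(2) finB order_refl]) (rule that)
    then have "v \<in> X \<longleftrightarrow> v \<in> Y" if "v \<in> B" for v
      using that by (auto simp only: right_minus_eq of_bool_eq_iff)
    then show "X = Y" using XY(1,2) by blast
  qed
  moreover have "?f ` Pow B = C"
  proof
    show "?f ` Pow B \<subseteq> C" using B(1) by (auto intro!: vec.subspace_sum[OF sub])
    show "C \<subseteq> ?f ` Pow B"
    proof
      fix c assume "c \<in> C"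
      then obtain u where u: "c = (\<Sum>v\<in>B. u v *s v)"
        using span vec.span_finite[OF finB] by auto
      let ?X = "{v\<in>B. u v = 1}"
      have "u v = of_bool (v \<in> ?X)" if "v \<in> B" for v
        using that by (cases "u v") auto
      then have "c = ?f ?X" unfolding u by (subst rep) (auto intro!: sum.cong)
      then show "c \<in> ?f ` Pow B" by blast
    qed
  qed
  ultimately have "card C = card (Pow B)" by (metis card_image)
  then show ?thesis using B(4) finB by (simp add: card_Pow)
qed

subsection \<open>Traces and quadratic forms in characteristic two\<close>

lemma CHAR_eq_2:
  assumes card: "CARD('a::finite_field) = 2 ^ m"
  shows "CHAR('a) = 2"
proof -
  have "CHAR('a) dvd 2 ^ m"
    using CHAR_dvd_CARD[where ?'a = 'a] card by simp
  moreover have "prime CHAR('a)"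
    by (rule prime_CHAR_semidom) (rule finite_imp_CHAR_pos, simp)
  ultimately show ?thesis
    by (metis prime_dvd_power primes_dvd_imp_eq two_is_prime_nat)
qed

text \<open>
  Sum over \<open>D\<close> the values of the polynomial with root set \<open>D - {r}\<close>: only \<open>r\<close> contributes.
\<close>

lemma power_sums_zero_imp_empty:
  fixes D :: "'b::field set"
  assumes "finite D" and sums: "\<And>k. k < card D \<Longrightarrow> (\<Sum>x\<in>D. x ^ k) = 0"
  shows "D = {}"
proof (rule ccontr)
  assume "D \<noteq> {}"
  then obtain r where r: "r \<in> D" by blast
  define P where "P = (\<Prod>y\<in>D - {r}. [:- y, 1:])"
  have "Polynomial.degree P = card (D - {r})"
    unfolding P_def by (subst degree_prod_eq_sum_degree) simp_all
  then have deg: "Polynomial.degree P < card D"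
    using r assms(1) by (simp add: card_gt_0_iff \<open>D \<noteq> {}\<close>)
  have eval: "poly P x = (\<Prod>y\<in>D - {r}. x - y)" for x
    by (simp add: P_def poly_prod)
  have "(\<Sum>x\<in>D. poly P x) = (\<Sum>k\<le>Polynomial.degree P. poly.coeff P k * (\<Sum>x\<in>D. x ^ k))"
    by (simp add: poly_altdef sum_distrib_left sum.swap[of _ D])
  also have "\<dots> = 0" using sums deg by (intro sum.neutral) auto
  also have "(\<Sum>x\<in>D. poly P x) = poly P r"
    using r assms(1) by (subst sum.remove[of _ r]) (auto simp: eval intro!: sum.neutral)
  finally show False using assms(1) by (simp add: eval)
qed

text \<open>
  With \<open>Q x = trace2 m (a x\<^sup>5 + b x\<^sup>3 + c x)\<close>, the zeros of this polynomial form the radical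
  of the bilinear form \<open>Q (x + z) + Q x + Q z\<close>: raising the summands of the latter to the 4th
  power, respectively squaring them, which does not change their trace, turns the form into
  \<open>trace2 m (x\<^sup>4 * radical_poly a b z)\<close>.
\<close>

definition radical_poly :: "'a::finite_field \<Rightarrow> 'a \<Rightarrow> 'a \<Rightarrow> 'a" where
  "radical_poly a b z = a * z + b\<^sup>2 * z ^ 2 + b ^ 4 * z ^ 8 + a ^ 4 * z ^ 16"

definition code_word :: "nat \<Rightarrow> 'a::finite_field \<Rightarrow> 'a \<Rightarrow> 'a \<Rightarrow> bit \<Rightarrow> (bit, 'a) vec" where
  "code_word m a b c h = (\<chi> x. trace2 m (a * x ^ 5 + b * x ^ 3 + c * x) + h)"

lemma trace_code_eq: "trace_code m = {code_word m a b c h | a b c h. True}"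
  by (simp add: trace_code_def code_word_def)

lemma code_word_mem: "code_word m a b c h \<in> trace_code m"
  unfolding trace_code_eq by blast

context
  fixes m :: nat
  assumes card: "CARD('a::finite_field) = 2 ^ m"
begin

lemma two_eq_0: "(2 :: 'a) = 0"
  using of_nat_CHAR[where ?'a = 'a] by (simp add: CHAR_eq_2[OF card])

lemma add_self: "x + x = (0 :: 'a)"
  using two_eq_0 by (metis mult_2 mult_zero_left)

lemma minus_eq: "- x = (x :: 'a)"
  using add_self minus_unique by blast

lemma power_two_power_add: "(x + y) ^ 2 ^ n = x ^ 2 ^ n + (y :: 'a) ^ 2 ^ n"
  by (rule freshmans_dream'[of _ n]) (simp_all add: CHAR_eq_2[OF card])

lemma power_two_power_inj: "x ^ 2 ^ n = y ^ 2 ^ n \<longleftrightarrow> x = (y :: 'a)"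
proof
  assume "x ^ 2 ^ n = y ^ 2 ^ n"
  then have "(x + y) ^ 2 ^ n = 0" by (simp add: power_two_power_add add_self)
  then show "x = y" by (metis add_self add_right_cancel power_not_zero)
qed simp

lemma exponent_pos: "m > 0"
proof (rule ccontr)
  assume "\<not> m > 0"
  then have "card {0, 1 :: 'a} \<le> 1"
    using card card_mono[of UNIV "{0, 1 :: 'a}"] by simp
  then show False by simp
qed

lemma of_bit_eq_iff: "(of_bit s :: 'a) = of_bit t \<longleftrightarrow> s = t"
  by (cases s; cases t) simp_all

lemma of_bit_add: "(of_bit (s + t) :: 'a) = of_bit s + of_bit t"
  by (cases s; cases t) (simp_all add: two_eq_0)

lemma trace2_add: "trace2 m (x + y :: 'a) = trace2 m x + trace2 m y"
proof -
  have "(of_bit (trace2 m (x + y)) :: 'a) = of_bit (trace2 m x + trace2 m y)"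
    unfolding of_bit_add of_bit_trace2[OF card]
    by (simp only: power_two_power_add sum.distrib)
  then show ?thesis by (simp only: of_bit_eq_iff)
qed

lemma trace2_0: "trace2 m (0 :: 'a) = 0"
  using trace2_add[of 0 0] by simp

lemma trace2_sum: "trace2 m (\<Sum>x\<in>D. f x :: 'a) = (\<Sum>x\<in>D. trace2 m (f x))"
  by (induction D rule: infinite_finite_induct) (simp_all add: trace2_0 trace2_add)

text \<open>Squaring permutes the conjugates of \<open>x\<close> cyclically, because
  \<open>x ^ 2 ^ m = x\<close>.\<close>

lemma trace2_square: "trace2 m (x ^ 2 :: 'a) = trace2 m x"
proof -
  have "(\<Sum>i<m. (x ^ 2) ^ 2 ^ i) + x = (\<Sum>i<Suc m. x ^ 2 ^ i)"
    by (simp only: sum.lessThan_Suc_shift power_0 power_one_right add.commute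
        power_mult[symmetric] power_Suc mult.commute)
  also have "\<dots> = (\<Sum>i<m. x ^ 2 ^ i) + x"
    using finite_field_power_card_eq_same[of x] card by (simp only: sum.lessThan_Suc)
  finally have "(\<Sum>i<m. (x ^ 2) ^ 2 ^ i) = (\<Sum>i<m. x ^ 2 ^ i)"
    by (rule add_right_imp_eq)
  then show ?thesis by (simp add: trace2_def)
qed

lemma trace2_power4: "trace2 m (x ^ 4 :: 'a) = trace2 m x"
  using trace2_square[of "x ^ 2"] by (simp add: trace2_square)

text \<open>Otherwise the trace polynomial, nonzero and of degree below \<open>2 ^ m\<close>, would
  vanish at all \<open>2 ^ m\<close> field elements.\<close>

lemma trace2_surj: "\<exists>x :: 'a. trace2 m x = 1"
proof (rule ccontr)
  assume "\<not> ?thesis"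
  then have zero: "trace2 m x = 0" for x :: 'a by (metis bit_not_zero_iff)
  define p :: "'a poly" where "p = (\<Sum>i<m. Polynomial.monom 1 (2 ^ i))"
  have coeff: "poly.coeff p k = (\<Sum>i<m. if 2 ^ i = k then 1 else 0)" for k
    unfolding p_def coeff_sum coeff_monom ..
  \<comment> \<open>Only \<open>i = 0\<close> contributes to the coefficient of degree 1, and
    \<open>m > 0\<close> ensures that this summand is present.\<close>
  have "poly.coeff p 1 = (\<Sum>i<m. if i = 0 then 1 else 0)"
    unfolding coeff by (intro sum.cong) auto
  then have "p \<noteq> 0" using exponent_pos by (auto simp: sum.delta)
  moreover have "poly p x = 0" for x
  proof -
    have "poly p x = (\<Sum>i<m. x ^ 2 ^ i)" by (simp add: p_def poly_sum poly_monom)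
    also have "\<dots> = 0" using zero[of x] of_bit_trace2[OF card, of x] by simp
    finally show ?thesis .
  qed
  ultimately have "2 ^ m \<le> Polynomial.degree p"
    using card_poly_roots_bound[of p] card by simp
  moreover have "Polynomial.degree p < 2 ^ m"
    unfolding p_def using exponent_pos
    by (intro degree_sum_less) (auto simp: degree_monom_eq power_strict_increasing)
  ultimately show False by simp
qed

lemma trace2_nondegenerate:
  assumes "\<And>c :: 'a. trace2 m (c * u) = 0"
  shows "u = 0"
proof (rule ccontr)
  assume "u \<noteq> 0"
  obtain x :: 'a where "trace2 m x = 1" using trace2_surj by blast
  with assms[of "x / u"] \<open>u \<noteq> 0\<close> show False by simp
qed

text \<open>Orthogonality of additive characters: by nondegeneracy only \<open>u = 0\<close> gives
  the trivial one.\<close>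

lemma sum_bit_sign_trace2:
  "(\<Sum>x\<in>UNIV. bit_sign (trace2 m (x * u :: 'a))) = (if u = 0 then 2 ^ m else 0)"
proof -
  have "(\<forall>x\<in>UNIV. trace2 m (x * u) = 0) \<longleftrightarrow> u = 0"
    using trace2_nondegenerate[of u] by (auto simp: trace2_0)
  then show ?thesis
    using card
    by (subst sum_bit_sign_additive) (simp_all add: distrib_right trace2_add)
qed

section \<open>The quadratic form and its radical\<close>

lemma trace2_form_add:
  fixes a b c x z :: 'a
  defines "f \<equiv> \<lambda>x. trace2 m (a * x ^ 5 + b * x ^ 3 + c * x)"
  shows "f (x + z) = f x + f z + trace2 m (x ^ 4 * radical_poly a b z)"
proof -
  let ?E = "a * x ^ 4 * z + (a * x * z ^ 4) + (b * x ^ 2 * z) + (b * x * z ^ 2)"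
  \<comment> \<open>\<open>?E\<close> keeps one copy of each mixed term with odd binomial
    coefficient; everything else is collected into a multiple of 2.\<close>
  have "a * (x + z) ^ 5 + b * (x + z) ^ 3 + c * (x + z)
      = (a * x ^ 5 + b * x ^ 3 + c * x) + (a * z ^ 5 + b * z ^ 3 + c * z) + ?E
        + 2 * (2 * a * x ^ 4 * z + 2 * a * x * z ^ 4 + 5 * a * x ^ 3 * z ^ 2
          + 5 * a * x ^ 2 * z ^ 3 + b * x ^ 2 * z + b * x * z ^ 2)"
    by (simp add: eval_nat_numeral algebra_simps)
  then have "f (x + z) = f x + f z + trace2 m ?E"
    unfolding f_def by (simp only: two_eq_0 mult_zero_left add_0_right trace2_add)
  also have "trace2 m ?E = trace2 m (a * x ^ 4 * z) + trace2 m ((a * x * z ^ 4) ^ 4)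
      + trace2 m ((b * x ^ 2 * z) ^ 2) + trace2 m ((b * x * z ^ 2) ^ 4)"
    by (simp only: trace2_add trace2_square trace2_power4)
  also have "\<dots> = trace2 m (x ^ 4 * radical_poly a b z)"
    unfolding trace2_add[symmetric] radical_poly_def
    by (rule arg_cong[where f = "trace2 m"])
      (simp add: power_mult_distrib algebra_simps flip: power_mult power_add)
  finally show ?thesis .
qed

lemma radical_poly_add:
  fixes a b y z :: 'a
  shows "radical_poly a b (y + z) = radical_poly a b y + radical_poly a b z"
proof -
  have "(y + z) ^ 2 = y ^ 2 + z ^ 2"
    using power_two_power_add[of y z 1] by (simp only: power_one_right)
  moreover have "(y + z) ^ 8 = y ^ 8 + z ^ 8"
    using power_two_power_add[of y z 3] by simp
  moreover have "(y + z) ^ 16 = y ^ 16 + z ^ 16"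
    using power_two_power_add[of y z 4] by simp
  ultimately show ?thesis
    by (simp only: radical_poly_def distrib_left add_ac)
qed

lemma card_radical_le:
  fixes a b :: 'a
  assumes "a \<noteq> 0 \<or> b \<noteq> 0"
  shows "card {z. radical_poly a b z = 0} \<le> 16"
proof -
  define p where "p = Polynomial.monom a 1 + Polynomial.monom (b\<^sup>2) 2
    + Polynomial.monom (b ^ 4) 8 + Polynomial.monom (a ^ 4) 16"
  have "poly.coeff p 1 = a" "poly.coeff p 2 = b\<^sup>2"
    by (simp_all add: p_def)
  then have "p \<noteq> 0" using assms by auto
  moreover have "poly p z = radical_poly a b z" for z
    by (simp add: p_def radical_poly_def poly_monom)
  moreover have "Polynomial.degree p \<le> 16"
    unfolding p_def by (intro degree_add_le order.trans[OF degree_monom_le]) simp_all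
  ultimately show ?thesis
    using card_poly_roots_bound[of p] by simp
qed

text \<open>The radical is closed under translation by \<open>r\<close>, an involution without fixed
  points. Parity is enough later: among the squares from 1 to 16 only 9 is not a power of
  two.\<close>

lemma radical_card_even:
  fixes a b r :: 'a
  assumes "radical_poly a b r = 0" "r \<noteq> 0"
  shows "even (card {z. radical_poly a b z = 0})"
proof -
  let ?R = "{z. radical_poly a b z = 0}"
  let ?P = "(\<lambda>z. {z, z + r}) ` ?R"
  have "\<Union> ?P = ?R"
    using assms(1) by (auto simp: radical_poly_add)
  moreover have "2 dvd card (\<Union> ?P)"
  proof (rule dvd_partition)
    show "\<forall>c\<in>?P. 2 dvd card c"
      using assms(2) by (auto simp: card_insert_if)
    have "(z + r) + r = z" for z :: 'a by (simp add: add.assoc add_self)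
    then show "\<forall>c1\<in>?P. \<forall>c2\<in>?P. c1 \<noteq> c2 \<longrightarrow> c1 \<inter> c2 = {}"
      by (auto simp: doubleton_eq_iff)
  qed simp
  ultimately show ?thesis by simp
qed

text \<open>In the square, written as a double sum, the second variable is replaced by
  \<open>x + z\<close>. By \<open>f_add\<close> the terms \<open>f x\<close> cancel, and what
  depends on \<open>x\<close> is a character whose sum vanishes unless \<open>z\<close> lies in
  \<open>R\<close>.\<close>

lemma char_sum_form_square:
  fixes a b c :: 'a and h :: bit
  defines "R \<equiv> {z. radical_poly a b z = 0}"
  defines "v \<equiv> code_word m a b c h"
  shows "char_sum v ^ 2 = 0 \<or> char_sum v ^ 2 = 2 ^ m * real (card R)"
proof -
  define f where "f x = trace2 m (a * x ^ 5 + b * x ^ 3 + c * x)" for x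
  have f_add: "f (x + z) = f x + f z + trace2 m (x ^ 4 * radical_poly a b z)" for x z
    unfolding f_def by (rule trace2_form_add)
  \<comment> \<open>The fourth power is an iterate of Frobenius, so \<open>x ^ 4\<close> may be
    replaced by \<open>x\<close> under the sum.\<close>
  have bij4: "bij_betw (\<lambda>x :: 'a. x ^ 4) UNIV UNIV"
    using power_two_power_inj[of _ 2] by (simp add: bij_betw_def inj_on_def finite_UNIV_inj_surj)
  have shift: "(\<Sum>z\<in>UNIV. g (x + z)) = (\<Sum>z\<in>UNIV. g z)" for x :: 'a and g :: "'a \<Rightarrow> real"
    by (rule sum.reindex_bij_betw) (simp add: bij_betw_def inj_on_def finite_UNIV_inj_surj)
  have "char_sum v = bit_sign h * (\<Sum>x\<in>UNIV. bit_sign (f x))"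
    by (simp add: char_sum_def v_def code_word_def f_def bit_sign_add sum_distrib_left mult.commute)
  then have "char_sum v ^ 2 = (\<Sum>x\<in>UNIV. bit_sign (f x)) * (\<Sum>z\<in>UNIV. bit_sign (f z))"
    by (simp add: power2_eq_square mult_ac)
  also have "\<dots> = (\<Sum>x\<in>UNIV. bit_sign (f x) * (\<Sum>z\<in>UNIV. bit_sign (f (x + z))))"
    by (simp add: shift[where g = "\<lambda>z. bit_sign (f z)"] sum_distrib_right)
  also have "\<dots> = (\<Sum>x\<in>UNIV. \<Sum>z\<in>UNIV.
      bit_sign (f z) * bit_sign (trace2 m (x ^ 4 * radical_poly a b z)))"
    by (simp add: sum_distrib_left f_add bit_sign_add flip: mult.assoc)
  also have "\<dots> = (\<Sum>z\<in>UNIV. bit_sign (f z)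
      * (\<Sum>x\<in>UNIV. bit_sign (trace2 m (x ^ 4 * radical_poly a b z))))"
    by (subst sum.swap) (simp add: sum_distrib_left)
  also have "\<dots> = (\<Sum>z\<in>UNIV. bit_sign (f z)
      * (\<Sum>x\<in>UNIV. bit_sign (trace2 m (x * radical_poly a b z))))"
    using sum.reindex_bij_betw[OF bij4, of "\<lambda>x. bit_sign (trace2 m (x * radical_poly a b z))" for z]
    by simp
  also have "\<dots> = (\<Sum>z\<in>R. 2 ^ m * bit_sign (f z))"
    unfolding sum_bit_sign_trace2 R_def by (intro sum.mono_neutral_cong_right) auto
  also have "\<dots> = 2 ^ m * (\<Sum>z\<in>R. bit_sign (f z))"
    by (simp add: sum_distrib_left)
  \<comment> \<open>On \<open>R\<close> the bilinear term of \<open>f_add\<close> is zero, so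
    \<open>f\<close> is additive there.\<close>
  also have "(\<Sum>z\<in>R. bit_sign (f z)) = (if \<forall>z\<in>R. f z = 0 then real (card R) else 0)"
    by (rule sum_bit_sign_additive) (auto simp: R_def f_add radical_poly_add trace2_0)
  finally show ?thesis by auto
qed

lemma char_sum_affine:
  fixes c :: 'a
  shows "char_sum (\<chi> x. trace2 m (c * x) + h) = (if c = 0 then bit_sign h * 2 ^ m else 0)"
  using sum_bit_sign_trace2[of c]
  by (simp add: char_sum_def bit_sign_add mult.commute flip: sum_distrib_left)

section \<open>The code as a subspace and its dual distance\<close>

lemma code_word_0: "code_word m 0 0 (0 :: 'a) h = (\<chi> x. h)"
  by (simp add: code_word_def trace2_0)

lemma code_word_add:
  fixes a b c a' b' c' :: 'a
  shows "code_word m a b c h + code_word m a' b' c' h'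
    = code_word m (a + a') (b + b') (c + c') (h + h')"
  by (simp add: code_word_def vec_eq_iff trace2_add distrib_right add_ac)

lemma subspace_trace_code: "vec.subspace (trace_code m :: (bit, 'a) vec set)"
proof (rule vec.subspaceI)
  show "0 \<in> (trace_code m :: (bit, 'a) vec set)"
    using code_word_mem[of m "0 :: 'a" 0 0 0] by (simp add: code_word_0 zero_vec_def)
  show "x + y \<in> trace_code m" if "x \<in> trace_code m" "y \<in> trace_code m" for x y :: "(bit, 'a) vec"
    using that code_word_mem by (auto simp: trace_code_eq code_word_add)
  then show "t *s x \<in> trace_code m" if "x \<in> trace_code m" for t and x :: "(bit, 'a) vec"
    using that \<open>0 \<in> trace_code m\<close> by (cases t) auto
qed

text \<open>A BCH-type bound. Varying \<open>a\<close>, \<open>b\<close>, \<open>c\<close> kills the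
  power sums of exponents 5, 3, 1; Frobenius gives 2 and 4; the constant word makes
  \<open>card D\<close> even, which gives exponent 0. These six sums suffice for up to six
  elements.\<close>

lemma trace_code_dual_distance:
  fixes D :: "'a set"
  assumes "D \<noteq> {}" "card D \<le> 6"
  shows "\<exists>v\<in>trace_code m. (\<Sum>x\<in>D. v $ x) \<noteq> 0"
proof (rule ccontr)
  assume "\<not> ?thesis"
  then have zero: "(\<Sum>x\<in>D. code_word m a b c h $ x) = 0" for a b c h
    using code_word_mem by blast
  have "trace2 m (u * (\<Sum>x\<in>D. x)) = 0" "trace2 m (u * (\<Sum>x\<in>D. x ^ 3)) = 0"
    "trace2 m (u * (\<Sum>x\<in>D. x ^ 5)) = 0" for u
    using zero[of 0 0 u 0] zero[of 0 u 0 0] zero[of u 0 0 0]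
    by (simp_all add: code_word_def sum_distrib_left trace2_sum)
  then have odd: "(\<Sum>x\<in>D. x) = 0" "(\<Sum>x\<in>D. x ^ 3) = 0" "(\<Sum>x\<in>D. x ^ 5) = 0"
    by (auto intro: trace2_nondegenerate)
  have freshman: "(\<Sum>x\<in>D. x ^ 2 ^ n) = (\<Sum>x\<in>D. x) ^ 2 ^ n" for n
    by (rule freshmans_dream_sum'[of _ n, symmetric]) (simp_all add: CHAR_eq_2[OF card])
  have even: "(\<Sum>x\<in>D. x ^ 2) = 0" "(\<Sum>x\<in>D. x ^ 4) = 0"
    using freshman[of 1] freshman[of 2] odd(1) by simp_all
  have "of_nat (card D) = (0 :: bit)"
    using zero[of 0 0 0 1] by (simp add: code_word_0)
  then have "even (card D)" by (metis even_of_nat even_zero)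
  then have card0: "of_nat (card D) = (0 :: 'a)"
    by (auto elim!: evenE simp: two_eq_0)
  then have "(\<Sum>x\<in>D. x ^ k) = 0" if "k < card D" for k
  proof -
    have "k \<in> {0, 1, 2, 3, 4, 5}" using that assms(2) by auto
    then show ?thesis using odd even card0 by auto
  qed
  then have "D = {}" by (rule power_sums_zero_imp_empty[rotated]) simp_all
  then show False using assms(1) by simp
qed

end

subsection \<open>Weights of the code\<close>

text \<open>Here \<open>q\<close> is the square of \<open>2 ^ s\<close>, so an integer whose square
  is \<open>q * card ?R\<close> has the form \<open>2 ^ s * k\<close> with
  \<open>k ^ 2 = card ?R \<le> 16\<close>.\<close>

lemma char_sum_code_word_values:
  fixes a b c :: "'a::finite_field"
  assumes card: "CARD('a) = 2 ^ (2 * s)" and ab: "a \<noteq> 0 \<or> b \<noteq> 0"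
  shows "char_sum (code_word (2 * s) a b c h) \<in>
    {0, 2 ^ s, - (2 ^ s), 2 * 2 ^ s, - (2 * 2 ^ s), 4 * 2 ^ s, - (4 * 2 ^ s)}"
proof -
  let ?S = "char_sum (code_word (2 * s) a b c h)"
  let ?R = "{z. radical_poly a b z = 0}"
  \<comment> \<open>The divisibility argument needs the character sum as an integer.\<close>
  define n where "n = int CARD('a) - 2 * int (hamming_weight (code_word (2 * s) a b c h))"
  have S: "?S = of_int n" by (simp add: char_sum_conv_weight n_def)
  have "?S ^ 2 = 0 \<or> ?S ^ 2 = 2 ^ (2 * s) * real (card ?R)"
    using char_sum_form_square[OF card, of a b c h] .
  then have "n = 0 \<or> real_of_int (n ^ 2) = real_of_int (2 ^ (2 * s) * int (card ?R))"
    unfolding S by simp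
  then have "n = 0 \<or> n ^ 2 = 2 ^ (2 * s) * int (card ?R)"
    unfolding of_int_eq_iff .
  then show ?thesis
  proof
    assume n: "n ^ 2 = 2 ^ (2 * s) * int (card ?R)"
    then have "(2 ^ s) ^ 2 dvd n ^ 2" by (simp add: mult.commute flip: power_mult)
    then obtain k where k: "n = 2 ^ s * k" by (auto elim: dvdE)
    with n have sq: "k ^ 2 = int (card ?R)"
      by (simp add: power_mult_distrib mult.commute flip: power_mult)
    then have "k ^ 2 \<le> 4 ^ 2" using card_radical_le[OF card ab] by simp
    then have "\<bar>k\<bar> \<le> 4" using abs_le_square_iff[of k 4] by simp
    then have cases: "k \<in> {-4, -3, -2, -1, 0, 1, 2, 3, 4}" by auto
    \<comment> \<open>A nonzero \<open>r\<close> in the radical pairs \<open>z\<close> with \<open>z + r\<close>, so the radical cannot have 9 elements.\<close>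
    have "k \<noteq> 3 \<and> k \<noteq> - 3"
    proof (rule ccontr)
      assume "\<not> ?thesis"
      then have card9: "card ?R = 9" using sq by auto
      then have "\<not> ?R \<subseteq> {0}" using card_mono[of "{0}" ?R] by auto
      then obtain r where "radical_poly a b r = 0" "r \<noteq> 0" by auto
      then have "even (card ?R)" by (rule radical_card_even[OF card])
      with card9 show False by simp
    qed
    with cases show ?thesis unfolding S k by auto
  qed (simp add: S)
qed

text \<open>For \<open>s \<ge> 3\<close> the largest value \<open>4 * 2 ^ s\<close> of a word with
  \<open>(a, b) \<noteq> (0, 0)\<close> stays below \<open>q\<close>; an affine word with
  \<open>c \<noteq> 0\<close> has sum \<open>0\<close>. Hence the parameters of a word can be
  recovered.\<close>

lemma char_sum_code_word_extreme:
  fixes a b c :: "'a::finite_field"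
  assumes card: "CARD('a) = 2 ^ (2 * s)" and s: "s \<ge> 3"
    and extreme: "\<bar>char_sum (code_word (2 * s) a b c h)\<bar> = 2 ^ (2 * s)"
  shows "a = 0 \<and> b = 0 \<and> c = 0"
proof -
  have "(2::real) ^ s \<ge> 2 ^ 3" using s by (intro power_increasing) auto
  then have "(2::real) ^ (2 * s) > 4 * 2 ^ s" by (simp add: mult_2 power_add)
  moreover have "\<bar>char_sum (code_word (2 * s) a b c h)\<bar> \<le> 4 * 2 ^ s" if "a \<noteq> 0 \<or> b \<noteq> 0"
    using char_sum_code_word_values[OF card that, of c h] by auto
  ultimately have "a = 0 \<and> b = 0"
    using extreme by fastforce
  moreover from this have "c = 0"
    using extreme char_sum_affine[OF card, of c h]
    by (auto simp: code_word_def split: if_splits)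
  ultimately show ?thesis by simp
qed

lemma card_trace_code:
  assumes card: "CARD('a::finite_field) = 2 ^ (2 * s)" and s: "s \<ge> 3"
  shows "card (trace_code (2 * s) :: (bit, 'a) vec set) = 2 ^ (6 * s + 1)"
proof -
  let ?f = "\<lambda>(a, b, c, h). code_word (2 * s) a b c h :: (bit, 'a) vec"
  have "inj ?f"
  proof (rule injI, unfold split_paired_all prod.case)
    fix a b c a' b' c' :: 'a and h h' :: bit
    assume "code_word (2 * s) a b c h = code_word (2 * s) a' b' c' h'"
    then have zero: "code_word (2 * s) (a + a') (b + b') (c + c') (h + h') = 0"
      using code_word_add[OF card, of a b c h a' b' c' h']
      by (metis add.commute bit_add_self vec_eq_iff vector_add_component zero_index)
    \<comment> \<open>The zero word attains the extreme value, which forces the differences of the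
      parameters to vanish.\<close>
    have "char_sum (0 :: (bit, 'a) vec) = 2 ^ (2 * s)"
      using card by (simp add: char_sum_def)
    then have eq: "a + a' = 0 \<and> b + b' = 0 \<and> c + c' = 0"
      using char_sum_code_word_extreme[OF card s] zero
      by (metis abs_of_nonneg zero_le_numeral zero_le_power)
    then have "h + h' = 0"
      using zero code_word_0[OF card, of "h + h'"] by (simp add: vec_eq_iff)
    show "(a, b, c, h) = (a', b', c', h')"
      using eq \<open>h + h' = 0\<close> minus_eq[OF card] by (auto simp: add_eq_0_iff2)
  qed
  moreover have "trace_code (2 * s) = range ?f"
    unfolding trace_code_eq by (auto simp: image_iff) blast
  moreover have "CARD(bit) = 2"
  proof -
    have "(UNIV :: bit set) = {0, 1}" using bit_not_zero_iff by blast
    then show ?thesis by (metis card_2_iff zero_neq_one)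
  qed
  ultimately have "card (trace_code (2 * s) :: (bit, 'a) vec set)
      = 2 ^ (2 * s) * (2 ^ (2 * s) * (2 ^ (2 * s) * 2))"
    by (simp add: card_image card card_cartesian_product flip: UNIV_Times_UNIV)
  moreover have "6 * s + 1 = 2 * s + (2 * s + (2 * s + 1))" by simp
  ultimately show ?thesis by (simp only: power_add power_one_right)
qed

section \<open>Multiplicities from the power moments\<close>

lemma char_sum_add_one: "char_sum (v + 1) = - char_sum v"
  by (simp add: char_sum_def bit_sign_add sum_negf)

text \<open>These are the even moments of a sum of \<open>q\<close> independent random
  signs.\<close>

lemma parity_walk_even_moments:
  "parity_walk q 2 0 = real q"
  "parity_walk q 4 0 = 3 * real q ^ 2 - 2 * real q"
  "parity_walk q 6 0 = 15 * real q ^ 3 - 30 * real q ^ 2 + 16 * real q"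
  by (simp_all add: eval_nat_numeral algebra_simps)

definition char_sum_count :: "(bit ^ 'n::finite) set \<Rightarrow> real \<Rightarrow> real" where
  "char_sum_count C \<sigma> = real (card {v \<in> C. char_sum v = \<sigma>})"

lemma weight_distribution_eq_count:
  fixes C :: "(bit ^ 'n::finite) set"
  assumes "\<sigma> = real CARD('n) - 2 * real w"
  shows "real (weight_distribution C w) = char_sum_count C \<sigma>"
  unfolding weight_distribution_def char_sum_count_def char_sum_conv_weight assms by simp

lemma char_sum_count_uminus:
  fixes C :: "(bit ^ 'n::finite) set"
  assumes "vec.subspace C" "1 \<in> C"
  shows "char_sum_count C (- \<sigma>) = char_sum_count C \<sigma>"
proof -
  have "bij_betw (\<lambda>v. v + 1) {v \<in> C. char_sum v = \<sigma>} {v \<in> C. char_sum v = - \<sigma>}"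
    using assms vec.subspace_add[OF assms(1)]
    by (intro bij_betwI[where g = "\<lambda>v. v + 1"])
      (auto simp: char_sum_add_one vec_eq_iff add.assoc)
  then show ?thesis
    by (simp add: char_sum_count_def bij_betw_same_card)
qed

lemma sum_power_char_sum:
  fixes C :: "(bit ^ 'n::finite) set"
  assumes "finite V" "char_sum ` C \<subseteq> V"
  shows "(\<Sum>v\<in>C. char_sum v ^ n) = (\<Sum>\<sigma>\<in>V. char_sum_count C \<sigma> * \<sigma> ^ n)"
proof -
  have "(\<Sum>v\<in>C. char_sum v ^ n) = (\<Sum>\<sigma>\<in>V. \<Sum>v\<in>{v \<in> C. char_sum v = \<sigma>}. char_sum v ^ n)"
    using assms by (intro sum.group[symmetric]) auto
  then show ?thesis by (simp add: char_sum_count_def)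
qed

lemma one_mem_trace_code:
  assumes card: "CARD('a::finite_field) = 2 ^ m"
  shows "(1 :: (bit, 'a) vec) \<in> trace_code m"
  using code_word_mem[of m "0 :: 'a" 0 0 1]
  by (simp add: code_word_0[OF card] one_vec_def)

lemma char_sum_distribution:
  fixes C :: "(bit ^ 'a::finite_field) set"
  assumes card: "CARD('a) = 2 ^ (2 * s)" and s: "s \<ge> 3" and C: "C = trace_code (2 * s)"
  defines "N \<equiv> char_sum_count C" and "Q \<equiv> 2 ^ s :: real"
  shows "char_sum ` C \<subseteq> {0, Q, - Q, 2 * Q, - (2 * Q), 4 * Q, - (4 * Q), Q ^ 2, - (Q ^ 2)}"
    and "N (Q ^ 2) = 1"
    and "N Q = 2 / 15 * Q ^ 2 * (3 * Q ^ 4 + 5 * Q ^ 2 - 8)"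
    and "N (2 * Q) = 7 / 48 * Q ^ 4 * (Q ^ 2 - 1)"
    and "N (4 * Q) = 1 / 960 * Q ^ 2 * (Q ^ 4 - 5 * Q ^ 2 + 4)"
    and "N 0 = 29 / 32 * Q ^ 6 - 33 / 32 * Q ^ 4 + 17 / 8 * Q ^ 2 - 2"
    and "\<And>\<sigma>. N (- \<sigma>) = N \<sigma>"
proof -
  let ?V = "{0, Q, - Q, 2 * Q, - (2 * Q), 4 * Q, - (4 * Q), Q ^ 2, - (Q ^ 2)}"
  have sub: "vec.subspace C"
    unfolding C by (rule subspace_trace_code[OF card])
  have Q2: "Q ^ 2 = 2 ^ (2 * s)" by (simp add: Q_def mult.commute flip: power_mult)
  have "Q \<ge> 2 ^ 3" unfolding Q_def using s by (intro power_increasing) auto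
  then have Q8: "Q \<ge> 8" by simp
  \<comment> \<open>This keeps \<open>Q ^ 2\<close> apart from \<open>4 * Q\<close>, so the nine
    listed values are distinct and the sum over \<open>?V\<close> has nine separate terms.\<close>
  then have Qsq: "Q ^ 2 > 4 * Q" by (simp add: power2_eq_square)
  show in_V: "char_sum ` C \<subseteq> ?V"
  proof (rule image_subsetI)
    fix v assume "v \<in> C"
    then obtain a b c h where v: "v = code_word (2 * s) a b c h"
      unfolding C trace_code_eq by blast
    show "char_sum v \<in> ?V"
    proof (cases "a = 0 \<and> b = 0")
      case True
      then show ?thesis
        using char_sum_affine[OF card, of c h] unfolding Q2
        by (cases h) (auto simp: v code_word_def)
    next
      case False
      then show ?thesis
        using char_sum_code_word_values[OF card, of a b c h] unfolding v Q_def by auto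
    qed
  qed
  have "v = 0" if "char_sum v = Q ^ 2" for v :: "(bit, 'a) vec"
    using that by (simp add: char_sum_conv_weight card Q2 hamming_weight_def vec_eq_iff)
  moreover have "char_sum (0 :: (bit, 'a) vec) = Q ^ 2"
    by (simp add: char_sum_def card Q2)
  ultimately have "{v \<in> C. char_sum v = Q ^ 2} = {0}"
    using vec.subspace_0[OF sub] by blast
  then show N_extreme: "N (Q ^ 2) = 1"
    unfolding N_def char_sum_count_def by simp
  show N_uminus: "N (- \<sigma>) = N \<sigma>" for \<sigma>
    unfolding N_def using sub one_mem_trace_code[OF card]
    by (intro char_sum_count_uminus) (simp_all add: C)
  have moment: "(\<Sum>\<sigma>\<in>?V. N \<sigma> * \<sigma> ^ n) = 2 * Q ^ 6 * parity_walk (2 ^ (2 * s)) n 0"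
    if "n \<le> 6" for n
  proof -
    have "(\<Sum>\<sigma>\<in>?V. N \<sigma> * \<sigma> ^ n) = (\<Sum>v\<in>C. char_sum v ^ n)"
      unfolding N_def by (rule sum_power_char_sum[symmetric]) (simp_all only: finite.intros in_V)
    also have "\<dots> = real (card C) * parity_walk CARD('a) n 0"
      using trace_code_dual_distance[OF card] that unfolding C
      by (intro char_sum_moments[OF sub[unfolded C]]) blast+
    also have "real (card C) = 2 * Q ^ 6"
      unfolding C card_trace_code[OF card s] by (simp add: Q_def mult.commute flip: power_mult)
    finally show ?thesis by (simp add: card)
  qed
  have expand: "(\<Sum>\<sigma>\<in>?V. N \<sigma> * \<sigma> ^ n) = N 0 * 0 ^ n
      + 2 * (N Q * Q ^ n + N (2 * Q) * (2 * Q) ^ n + N (4 * Q) * (4 * Q) ^ n + N (Q ^ 2) * (Q ^ 2) ^ n)"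
    if "even n" for n
    using Q8 Qsq that by (simp add: N_uminus)
  \<comment> \<open>Since \<open>0 ^ 0 = 1\<close>, the unknown \<open>N 0\<close> enters only here;
    the moments 2, 4, 6 fix the other three multiplicities.\<close>
  have m0: "N 0 + 2 * (N Q + N (2 * Q) + N (4 * Q) + 1) = 2 * Q ^ 6"
    using moment[of 0] expand[of 0] by (simp add: N_extreme)
  have "even (2 :: nat)" "even (4 :: nat)" "even (6 :: nat)" by simp_all
  note expands = this[THEN expand, symmetric]
  have q: "real (2 ^ (2 * s)) = Q ^ 2" by (simp add: Q2)
  \<comment> \<open>The contribution of the zero word and the all-one word, with values
    \<open>Q ^ 2\<close> and \<open>- (Q ^ 2)\<close>, is moved to the right; likewise for the
    moments 4 and 6.\<close>
  have "(2 * Q ^ 2) * (N Q + 4 * N (2 * Q) + 16 * N (4 * Q)) = (2 * Q ^ 2) * (Q ^ 6 - Q ^ 2)"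
    using trans[OF expands(1) moment] unfolding parity_walk_even_moments q N_extreme
    by (simp add: eval_nat_numeral algebra_simps)
  then have m2: "N Q + 4 * N (2 * Q) + 16 * N (4 * Q) = Q ^ 6 - Q ^ 2"
    using Q8 by simp
  have "(2 * Q ^ 4) * (N Q + 16 * N (2 * Q) + 256 * N (4 * Q)) = (2 * Q ^ 4) * (3 * Q ^ 6 - 3 * Q ^ 4)"
    using trans[OF expands(2) moment] unfolding parity_walk_even_moments q N_extreme
    by (simp add: eval_nat_numeral algebra_simps)
  then have m4: "N Q + 16 * N (2 * Q) + 256 * N (4 * Q) = 3 * Q ^ 6 - 3 * Q ^ 4"
    using Q8 by simp
  have "(2 * Q ^ 6) * (N Q + 64 * N (2 * Q) + 4096 * N (4 * Q))
      = (2 * Q ^ 6) * (14 * Q ^ 6 - 30 * Q ^ 4 + 16 * Q ^ 2)"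
    using trans[OF expands(3) moment] unfolding parity_walk_even_moments q N_extreme
    by (simp add: eval_nat_numeral algebra_simps)
  then have m6: "N Q + 64 * N (2 * Q) + 4096 * N (4 * Q) = 14 * Q ^ 6 - 30 * Q ^ 4 + 16 * Q ^ 2"
    using Q8 by simp
  \<comment> \<open>With products merged, \<open>Q ^ 2\<close>, \<open>Q ^ 4\<close> and
    \<open>Q ^ 6\<close> act as atoms and the system is linear in the four unknowns.\<close>
  have prods: "Q ^ 2 * Q ^ 4 = Q ^ 6" "Q ^ 2 * Q ^ 2 = Q ^ 4" "Q ^ 4 * Q ^ 2 = Q ^ 6"
    by (simp_all flip: power_add)
  show "N Q = 2 / 15 * Q ^ 2 * (3 * Q ^ 4 + 5 * Q ^ 2 - 8)"
    and "N (2 * Q) = 7 / 48 * Q ^ 4 * (Q ^ 2 - 1)"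
    and "N (4 * Q) = 1 / 960 * Q ^ 2 * (Q ^ 4 - 5 * Q ^ 2 + 4)"
    and "N 0 = 29 / 32 * Q ^ 6 - 33 / 32 * Q ^ 4 + 17 / 8 * Q ^ 2 - 2"
    using m0 m2 m4 m6
    by (simp_all only: distrib_left right_diff_distrib mult.assoc mult.left_commute[of "Q ^ _"] prods)
qed

theorem theorem4:
  fixes s m q :: nat and C :: "(bit ^ 'a::finite_field) set"
  assumes "s \<ge> 3" and "m = 2 * s" and "q = 2 ^ m" and "CARD('a) = q"
    and "C = trace_code m"
  shows "code_length C = 2 ^ m
    \<and> vec.subspace C
    \<and> vec.dim C = 3 * m + 1
    \<and> weight_distribution C 0 = 1
    \<and> real (weight_distribution C (2 ^ (2 * s - 1)))
      = 29 * 2 ^ (6 * s - 5) - 33 * 2 ^ (4 * s - 5) + 17 * 2 ^ (2 * s - 3) - 2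
    \<and> real (weight_distribution C (2 ^ (2 * s - 1) - 2 ^ (s - 1)))
      = 2 / 15 * 2 ^ (2 * s) * (3 * 2 ^ (4 * s) + 5 * 2 ^ (2 * s) - 8)
    \<and> real (weight_distribution C (2 ^ (2 * s - 1) + 2 ^ (s - 1)))
      = 2 / 15 * 2 ^ (2 * s) * (3 * 2 ^ (4 * s) + 5 * 2 ^ (2 * s) - 8)
    \<and> real (weight_distribution C (2 ^ (2 * s - 1) - 2 ^ s))
      = 7 / 3 * 2 ^ (4 * s - 4) * (2 ^ (2 * s) - 1)
    \<and> real (weight_distribution C (2 ^ (2 * s - 1) + 2 ^ s))
      = 7 / 3 * 2 ^ (4 * s - 4) * (2 ^ (2 * s) - 1)
    \<and> real (weight_distribution C (2 ^ (2 * s - 1) - 2 ^ (s + 1)))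
      = 1 / 15 * 2 ^ (2 * s - 4) * (2 ^ (4 * s - 2) - 5 * 2 ^ (2 * s - 2) + 1)
    \<and> real (weight_distribution C (2 ^ (2 * s - 1) + 2 ^ (s + 1)))
      = 1 / 15 * 2 ^ (2 * s - 4) * (2 ^ (4 * s - 2) - 5 * 2 ^ (2 * s - 2) + 1)
    \<and> weight_distribution C (2 ^ (2 * s)) = 1
    \<and> (\<forall>w. w \<notin> {0, 2 ^ (2 * s - 1),
            2 ^ (2 * s - 1) - 2 ^ (s - 1), 2 ^ (2 * s - 1) + 2 ^ (s - 1),
            2 ^ (2 * s - 1) - 2 ^ s, 2 ^ (2 * s - 1) + 2 ^ s,
            2 ^ (2 * s - 1) - 2 ^ (s + 1), 2 ^ (2 * s - 1) + 2 ^ (s + 1), 2 ^ (2 * s)}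
          \<longrightarrow> weight_distribution C w = 0)"
proof -
  have card: "CARD('a) = 2 ^ (2 * s)" and C: "C = trace_code (2 * s)"
    using assms by simp_all
  note dist = char_sum_distribution[OF card assms(1) C]
  define Q :: real where "Q = 2 ^ s"
  let ?N = "char_sum_count C"
  have sub: "vec.subspace C"
    unfolding C by (rule subspace_trace_code[OF card])
  have "2 ^ vec.dim C = (2 :: nat) ^ (6 * s + 1)"
    using card_subspace_bit[OF sub] card_trace_code[OF card assms(1)] C by simp
  then have "vec.dim C = 6 * s + 1"
    by (simp only: power_inject_exp)
  then have dim: "vec.dim C = 3 * m + 1"
    using assms(2) by simp
  have pow: "(2::real) ^ (k * s - j) = Q ^ k / 2 ^ j" if "j \<le> k * s" for j k
    using that by (simp add: Q_def power_diff mult.commute flip: power_mult)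
  have powers1: "(2::real) ^ (2 * s - 1) = Q ^ 2 / 2" "(2::real) ^ (2 * s - 2) = Q ^ 2 / 4"
    "(2::real) ^ (2 * s - 3) = Q ^ 2 / 8" "(2::real) ^ (2 * s - 4) = Q ^ 2 / 16"
    "(2::real) ^ (4 * s - 2) = Q ^ 4 / 4" "(2::real) ^ (4 * s - 4) = Q ^ 4 / 16"
    "(2::real) ^ (4 * s - 5) = Q ^ 4 / 32" "(2::real) ^ (6 * s - 5) = Q ^ 6 / 32"
    by (subst pow, use assms(1) in linarith, simp)+
  have powers2: "(2::real) ^ (s - 1) = Q / 2"
    using assms(1) by (simp add: Q_def power_diff)
  have powers3: "(2::real) ^ (2 * s) = Q ^ 2" "(2::real) ^ (4 * s) = Q ^ 4"
    "(2::real) ^ (s + 1) = 2 * Q" "(2::real) ^ s = Q"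
    by (simp_all add: Q_def mult.commute flip: power_mult)
  note powers = powers1 powers2 powers3
  \<comment> \<open>The subtractions in the listed weights are on naturals; these bounds show that
    none is truncated.\<close>
  have le: "(2::nat) ^ (s - 1) \<le> 2 ^ (2 * s - 1)" "(2::nat) ^ s \<le> 2 ^ (2 * s - 1)"
    "(2::nat) ^ (s + 1) \<le> 2 ^ (2 * s - 1)"
    using assms(1) by (auto intro!: power_increasing simp del: power_Suc power.simps(2))
  have weights: "real (2 ^ (2 * s - 1)) = Q ^ 2 / 2"
    "real (2 ^ (2 * s - 1) - 2 ^ (s - 1)) = Q ^ 2 / 2 - Q / 2"
    "real (2 ^ (2 * s - 1) + 2 ^ (s - 1)) = Q ^ 2 / 2 + Q / 2"
    "real (2 ^ (2 * s - 1) - 2 ^ s) = Q ^ 2 / 2 - Q"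
    "real (2 ^ (2 * s - 1) + 2 ^ s) = Q ^ 2 / 2 + Q"
    "real (2 ^ (2 * s - 1) - 2 ^ (s + 1)) = Q ^ 2 / 2 - 2 * Q"
    "real (2 ^ (2 * s - 1) + 2 ^ (s + 1)) = Q ^ 2 / 2 + 2 * Q"
    "real (2 ^ (2 * s)) = Q ^ 2" "real 0 = 0"
    by (simp_all only: of_nat_diff[OF le(1)] of_nat_diff[OF le(2)] of_nat_diff[OF le(3)]
        of_nat_add of_nat_power of_nat_numeral powers of_nat_0)
  \<comment> \<open>Weight \<open>Q ^ 2 / 2 - t\<close> corresponds to the character sum
    \<open>2 * t\<close>.\<close>
  have W: "real (weight_distribution C w) = ?N \<sigma>" if "\<sigma> = Q ^ 2 - 2 * real w" for w \<sigma>
    using that by (intro weight_distribution_eq_count) (simp add: card powers3)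
  have counts: "real (weight_distribution C 0) = ?N (Q ^ 2)"
    "real (weight_distribution C (2 ^ (2 * s - 1))) = ?N 0"
    "real (weight_distribution C (2 ^ (2 * s - 1) - 2 ^ (s - 1))) = ?N Q"
    "real (weight_distribution C (2 ^ (2 * s - 1) + 2 ^ (s - 1))) = ?N (- Q)"
    "real (weight_distribution C (2 ^ (2 * s - 1) - 2 ^ s)) = ?N (2 * Q)"
    "real (weight_distribution C (2 ^ (2 * s - 1) + 2 ^ s)) = ?N (- (2 * Q))"
    "real (weight_distribution C (2 ^ (2 * s - 1) - 2 ^ (s + 1))) = ?N (4 * Q)"
    "real (weight_distribution C (2 ^ (2 * s - 1) + 2 ^ (s + 1))) = ?N (- (4 * Q))"
    "real (weight_distribution C (2 ^ (2 * s))) = ?N (- (Q ^ 2))"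
    by (rule W, unfold weights, simp add: algebra_simps)+
  let ?W = "{0, 2 ^ (2 * s - 1), 2 ^ (2 * s - 1) - 2 ^ (s - 1), 2 ^ (2 * s - 1) + 2 ^ (s - 1),
      2 ^ (2 * s - 1) - 2 ^ s, 2 ^ (2 * s - 1) + 2 ^ s,
      2 ^ (2 * s - 1) - 2 ^ (s + 1), 2 ^ (2 * s - 1) + 2 ^ (s + 1), 2 ^ (2 * s)} :: nat set"
  have other: "weight_distribution C w = 0"
    if w: "w \<notin> ?W" for w
  proof -
    have "hamming_weight v \<noteq> w" if "v \<in> C" for v
    proof
      assume "hamming_weight v = w"
      then have weight: "char_sum v = Q ^ 2 - 2 * real w"
        by (simp add: char_sum_conv_weight card powers3)
      have "Q ^ 2 - 2 * real w \<in>
          {0, Q, - Q, 2 * Q, - (2 * Q), 4 * Q, - (4 * Q), Q ^ 2, - (Q ^ 2)}"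
        using subsetD[OF dist(1) imageI[OF \<open>v \<in> C\<close>]] unfolding weight Q_def .
      then have "real w \<in> {0, Q ^ 2 / 2, Q ^ 2 / 2 - Q / 2, Q ^ 2 / 2 + Q / 2, Q ^ 2 / 2 - Q,
          Q ^ 2 / 2 + Q, Q ^ 2 / 2 - 2 * Q, Q ^ 2 / 2 + 2 * Q, Q ^ 2}"
        unfolding insert_iff empty_iff by argo
      \<comment> \<open>The weights are compared as reals and pulled back along the injection
        \<open>real\<close>.\<close>
      then have "real w \<in> real ` ?W"
        by (simp only: image_insert image_empty weights)
      then show False
        using w by (simp only: inj_image_mem_iff[OF inj_of_nat])
    qed
    then have "{v \<in> C. hamming_weight v = w} = {}" by blast
    then show ?thesis unfolding weight_distribution_def by simp
  qed
  have "weight_distribution C 0 = 1" "weight_distribution C (2 ^ (2 * s)) = 1"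
    using counts(1,9) dist(2,7) unfolding Q_def[symmetric] by simp_all
  moreover have "code_length C = 2 ^ m"
    using assms by (simp add: code_length_def)
  moreover have "?N 0 = 29 * (Q ^ 6 / 32) - 33 * (Q ^ 4 / 32) + 17 * (Q ^ 2 / 8) - 2"
    "?N (2 * Q) = 7 / 3 * (Q ^ 4 / 16) * (Q ^ 2 - 1)"
    "?N (4 * Q) = 1 / 15 * (Q ^ 2 / 16) * (Q ^ 4 / 4 - 5 * (Q ^ 2 / 4) + 1)"
    using dist(4-6) unfolding Q_def[symmetric] by (simp_all add: algebra_simps)
  moreover note sub dim other dist(3)[folded Q_def]
  ultimately show ?thesis
    unfolding counts powers dist(7) by blast
qed

end
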